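(* Let $X_1$ and $X_2$ be metric spaces with unbounded metrics. If $X_1$ and $X_2$ are quasi-isometric, then $R(X_1,Y)=R(X_2,Y)$ for every metric space $Y$.
   Context: A function $\phi:X\to Y$ between metric spaces is a quasi-isometry if there are $C>0$, $D\ge0$ with $C^{-1}d_X(x,x')-D\le d_Y(\phi(x),\phi(x'))\le C\,d_X(x,x')+D$ for all $x,x'\in X$. The spaces $X$ and $Y$ are quasi-isometric if there exist a quasi-isometry $\phi:X\to Y$ and $K>0$ such that every element of $Y$ is within distance $K$ of the image of $\phi$. A function $f:X\to Y$ is large-scale Lipschitz if there are $C>0$, $D\ge 0$ with $d_Y(f(x),f(x'))\le C\,d_X(x,x')+D$ for all $x,x'\in X$; the set of such maps is $\mathrm{Lip}^{ls}(X,Y)$. Let $X$ be a metric space with unbounded metric. The compression of $f\in\mathrm{Lip}^{ls}(X,Y)$ is $\rho_f(r)=\inf_{d_X(x,y)\ge r} d_Y(f(x),f(y))$. With $\rho_f^*(r)=\max\{\rho_f(r),1\}$, the asymptotic compression of $f$ is $R_f=\liminf_{r\to\infty}\frac{\log\rho_f^*(r)}{\log r}$. The compression of $X$ in $Y$ is $R(X,Y)=\sup\{R_f: f\in\mathrm{Lip}^{ls}(X,Y)\}$. *)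

theory Defs
  imports "HOL-Analysis.Analysis"
begin

definition quasi_isometry :: "'a metric \<Rightarrow> 'b metric \<Rightarrow> ('a \<Rightarrow> 'b) \<Rightarrow> bool" where
  "quasi_isometry X Y \<phi> \<longleftrightarrow>
     \<phi> \<in> mspace X \<rightarrow> mspace Y \<and>
     (\<exists>C>0. \<exists>D\<ge>0. \<forall>x\<in>mspace X. \<forall>x'\<in>mspace X.
        inverse C * mdist X x x' - D \<le> mdist Y (\<phi> x) (\<phi> x') \<and>
        mdist Y (\<phi> x) (\<phi> x') \<le> C * mdist X x x' + D)"

definition quasi_isometric :: "'a metric \<Rightarrow> 'b metric \<Rightarrow> bool" where
  "quasi_isometric X Y \<longleftrightarrow>
     (\<exists>\<phi>. quasi_isometry X Y \<phi> \<and>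
          (\<exists>K>0. \<forall>y\<in>mspace Y. \<exists>x\<in>mspace X. mdist Y y (\<phi> x) \<le> K))"

definition ls_Lipschitz_maps :: "'a metric \<Rightarrow> 'b metric \<Rightarrow> ('a \<Rightarrow> 'b) set" where
  "ls_Lipschitz_maps X Y =
     {f. f \<in> mspace X \<rightarrow> mspace Y \<and>
         (\<exists>C>0. \<exists>D\<ge>0. \<forall>x\<in>mspace X. \<forall>x'\<in>mspace X.
            mdist Y (f x) (f x') \<le> C * mdist X x x' + D)}"

definition unbounded_metric :: "'a metric \<Rightarrow> bool" where
  "unbounded_metric X \<longleftrightarrow> \<not> Metric_space.mbounded (mspace X) (mdist X) (mspace X)"

text \<open>For \<open>X\<close> with unbounded metric the set below is nonempty for every \<open>r\<close>, and it is bounded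
  below by \<open>0\<close>, so the real-valued infimum is the true one. For bounded \<open>X\<close> the value at large \<open>r\<close>
  is an infimum over the empty set and carries no meaning.\<close>

definition compression :: "'a metric \<Rightarrow> 'b metric \<Rightarrow> ('a \<Rightarrow> 'b) \<Rightarrow> real \<Rightarrow> real" where
  "compression X Y f r =
     Inf {mdist Y (f x) (f y) | x y. x \<in> mspace X \<and> y \<in> mspace X \<and> mdist X x y \<ge> r}"

definition asymptotic_compression :: "'a metric \<Rightarrow> 'b metric \<Rightarrow> ('a \<Rightarrow> 'b) \<Rightarrow> ereal" where
  "asymptotic_compression X Y f =
     Liminf at_top (\<lambda>r::real. ereal (ln (max (compression X Y f r) 1) / ln r))"

text \<open>If \<open>Y\<close> is empty and \<open>X\<close> is not, there are no maps and the supremum is \<open>-\<infinity>\<close>.\<close>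

definition compression_in :: "'a metric \<Rightarrow> 'b metric \<Rightarrow> ereal" where
  "compression_in X Y = (SUP f \<in> ls_Lipschitz_maps X Y. asymptotic_compression X Y f)"

end

theory Submission
  imports Defs "HOL-Real_Asymp.Real_Asymp"
begin

text \<open>Precomposition with a quasi-isometry replaces \<open>\<rho>\<^sub>f(r)\<close> by a function that is at least
  \<open>\<rho>\<^sub>f(r/C - D)\<close>. Since \<open>ln (r/C - D) / ln r\<close> tends to \<open>1\<close>, this does not decrease the asymptotic
  compression, so \<open>R(X\<^sub>2,Y) \<le> R(X\<^sub>1,Y)\<close>. The reverse inequality comes from a coarse inverse of the
  quasi-isometry.\<close>

text \<open>Keeps the set whose infimum defines \<open>compression\<close> nonempty for every
  \<open>r\<close>.\<close>

lemma unbounded_metric_far_points: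
  assumes "unbounded_metric X"
  obtains x y where "x \<in> mspace X" "y \<in> mspace X" "r \<le> mdist X x y"
proof -
  interpret Metric_space "mspace X" "mdist X"
    by (rule Metric_space_mspace_mdist)
  have "\<not> (\<forall>x\<in>mspace X. \<forall>y\<in>mspace X. mdist X x y \<le> r)"
    using assms unfolding unbounded_metric_def mbounded_alt by blast
  then show ?thesis
    using that by fastforce
qed

lemma mdist_quadrilateral:
  assumes "x \<in> mspace X" "x' \<in> mspace X" "y \<in> mspace X" "y' \<in> mspace X"
  shows "mdist X x y \<le> mdist X x x' + mdist X x' y' + mdist X y y'"
  using mdist_triangle[of x X x' y] mdist_triangle[of x' X y' y] mdist_commute[of X y y'] assms
  by linarith

text \<open>A coarse inverse \<open>\<psi>\<close> sends each \<open>z\<close> to a point whose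
  image under \<open>\<phi>\<close> lies within \<open>K\<close> of \<open>z\<close>. The two bounds
  on \<open>\<phi>\<close> exchange roles and become bounds on \<open>\<psi>\<close>, up to additive
  error.\<close>

lemma quasi_isometric_sym:
  assumes "quasi_isometric X Z"
  shows "quasi_isometric Z X"
proof -
  obtain \<phi> K where qi: "quasi_isometry X Z \<phi>" and K: "K > 0"
    and dense: "\<And>z. z \<in> mspace Z \<Longrightarrow> \<exists>x\<in>mspace X. mdist Z z (\<phi> x) \<le> K"
    using assms unfolding quasi_isometric_def by blast
  obtain C D where C: "C > 0" and D: "D \<ge> 0"
    and lo: "\<And>x x'. x \<in> mspace X \<Longrightarrow> x' \<in> mspace X \<Longrightarrow>
      inverse C * mdist X x x' - D \<le> mdist Z (\<phi> x) (\<phi> x')"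
    and up: "\<And>x x'. x \<in> mspace X \<Longrightarrow> x' \<in> mspace X \<Longrightarrow>
      mdist Z (\<phi> x) (\<phi> x') \<le> C * mdist X x x' + D"
    using qi unfolding quasi_isometry_def by blast
  have \<phi>: "\<phi> x \<in> mspace Z" if "x \<in> mspace X" for x
    using qi that unfolding quasi_isometry_def by blast
  obtain \<psi> where \<psi>: "\<And>z. z \<in> mspace Z \<Longrightarrow> \<psi> z \<in> mspace X"
    and near: "\<And>z. z \<in> mspace Z \<Longrightarrow> mdist Z z (\<phi> (\<psi> z)) \<le> K"
    using dense by metis
  have lo_inv: "mdist X (\<psi> z) (\<psi> z') \<le> C * mdist Z z z' + C * (2 * K + D)"
    if "z \<in> mspace Z" "z' \<in> mspace Z" for z z'
  proof -
    \<comment> \<open>Replacing each endpoint by its \<open>K\<close>-close partner costs at most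
      \<open>K\<close>, hence \<open>2 * K\<close> in total.\<close>
    have "mdist Z (\<phi> (\<psi> z)) (\<phi> (\<psi> z')) \<le> mdist Z z z' + 2 * K"
      using mdist_quadrilateral[of "\<phi> (\<psi> z)" Z z "\<phi> (\<psi> z')" z'] near[of z] near[of z'] \<phi> \<psi> that
      by (simp add: mdist_commute)
    then have "inverse C * mdist X (\<psi> z) (\<psi> z') \<le> mdist Z z z' + (2 * K + D)"
      using lo[of "\<psi> z" "\<psi> z'"] \<psi> that by fastforce
    then show ?thesis
      using C by (simp add: field_simps)
  qed
  have up_inv: "inverse C * mdist Z z z' - inverse C * (2 * K + D) \<le> mdist X (\<psi> z) (\<psi> z')"
    if "z \<in> mspace Z" "z' \<in> mspace Z" for z z'
  proof -
    have "mdist Z z z' \<le> C * mdist X (\<psi> z) (\<psi> z') + (2 * K + D)"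
      using mdist_quadrilateral[of z Z "\<phi> (\<psi> z)" z' "\<phi> (\<psi> z')"] near[of z] near[of z']
        up[of "\<psi> z" "\<psi> z'"] \<phi> \<psi> that
      by fastforce
    then show ?thesis
      using C by (simp add: field_simps)
  qed
  have "quasi_isometry Z X \<psi>"
    unfolding quasi_isometry_def
  proof (intro conjI exI ballI)
    \<comment> \<open>The upper and lower bounds come with different additive errors; their sum
      serves both, as each is nonnegative.\<close>
    let ?D = "C * (2 * K + D) + inverse C * (2 * K + D)"
    have nonneg: "0 \<le> C * (2 * K + D)" "0 \<le> inverse C * (2 * K + D)"
      using C D K by simp_all
    then show "0 \<le> ?D"
      by simp
    fix z z' assume "z \<in> mspace Z" "z' \<in> mspace Z"
    then show "inverse C * mdist Z z z' - ?D \<le> mdist X (\<psi> z) (\<psi> z')"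
      and "mdist X (\<psi> z) (\<psi> z') \<le> C * mdist Z z z' + ?D"
      using lo_inv[of z z'] up_inv[of z z'] nonneg by linarith+
  qed (use \<psi> C in auto)
  moreover have "\<exists>z\<in>mspace Z. mdist X x (\<psi> z) \<le> C * (K + D)" if "x \<in> mspace X" for x
  proof
    \<comment> \<open>The witness is \<open>\<phi> x\<close>: the images of \<open>x\<close> and
      \<open>\<psi> (\<phi> x)\<close> are \<open>K\<close>-close, so the lower bound on
      \<open>\<phi>\<close> keeps the points themselves close.\<close>
    show "\<phi> x \<in> mspace Z"
      using \<phi> that .
    then have "inverse C * mdist X x (\<psi> (\<phi> x)) \<le> K + D"
      using lo[of x "\<psi> (\<phi> x)"] near[of "\<phi> x"] \<psi> that by fastforce
    then show "mdist X x (\<psi> (\<phi> x)) \<le> C * (K + D)"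
      using C by (simp add: field_simps)
  qed
  moreover have "C * (K + D) > 0"
    using C K D by simp
  ultimately show ?thesis
    unfolding quasi_isometric_def by blast
qed

lemma ls_Lipschitz_maps_compose:
  assumes "g \<in> ls_Lipschitz_maps X Z" "f \<in> ls_Lipschitz_maps Z Y"
  shows "f \<circ> g \<in> ls_Lipschitz_maps X Y"
proof -
  obtain C D where g: "g \<in> mspace X \<rightarrow> mspace Z" and CD: "C > 0" "D \<ge> 0"
    and g_le: "\<And>x x'. x \<in> mspace X \<Longrightarrow> x' \<in> mspace X \<Longrightarrow>
      mdist Z (g x) (g x') \<le> C * mdist X x x' + D"
    using assms(1) unfolding ls_Lipschitz_maps_def by blast
  obtain A B where f: "f \<in> mspace Z \<rightarrow> mspace Y" and AB: "A > 0" "B \<ge> 0"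
    and f_le: "\<And>z z'. z \<in> mspace Z \<Longrightarrow> z' \<in> mspace Z \<Longrightarrow>
      mdist Y (f z) (f z') \<le> A * mdist Z z z' + B"
    using assms(2) unfolding ls_Lipschitz_maps_def by blast
  have "mdist Y (f (g x)) (f (g x')) \<le> (A * C) * mdist X x x' + (A * D + B)"
    if "x \<in> mspace X" "x' \<in> mspace X" for x x'
  proof -
    have "mdist Y (f (g x)) (f (g x')) \<le> A * mdist Z (g x) (g x') + B"
      using f_le g that by blast
    also have "\<dots> \<le> A * (C * mdist X x x' + D) + B"
      using g_le[OF that] AB by simp
    finally show ?thesis
      by (simp add: algebra_simps)
  qed
  moreover have "A * C > 0" "A * D + B \<ge> 0"
    using AB CD by simp_all
  moreover have "f \<circ> g \<in> mspace X \<rightarrow> mspace Y"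
    using f g by auto
  ultimately show ?thesis
    unfolding ls_Lipschitz_maps_def by fastforce
qed

lemma quasi_isometry_imp_ls_Lipschitz:
  "quasi_isometry X Z \<phi> \<Longrightarrow> \<phi> \<in> ls_Lipschitz_maps X Z"
  unfolding quasi_isometry_def ls_Lipschitz_maps_def by blast

text \<open>Pairs at distance at least \<open>r\<close> in \<open>X\<close> map to pairs at distance
  at least \<open>s\<close> in \<open>Z\<close>, so the infimum for \<open>f \<circ> \<phi>\<close>
  runs over a subset of the values for \<open>f\<close>. That subset must be nonempty for real
  infima to compare.\<close>

lemma compression_compose_ge:
  assumes "unbounded_metric X" and "\<phi> \<in> mspace X \<rightarrow> mspace Z"
    and "\<And>x x'. x \<in> mspace X \<Longrightarrow> x' \<in> mspace X \<Longrightarrow> r \<le> mdist X x x' \<Longrightarrow> s \<le> mdist Z (\<phi> x) (\<phi> x')"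
  shows "compression Z Y f s \<le> compression X Y (f \<circ> \<phi>) r"
  unfolding compression_def
proof (rule cInf_superset_mono)
  show "{mdist Y ((f \<circ> \<phi>) x) ((f \<circ> \<phi>) y) |x y. x \<in> mspace X \<and> y \<in> mspace X \<and> r \<le> mdist X x y} \<noteq> {}"
    using unbounded_metric_far_points[OF assms(1), of r] by blast
  show "bdd_below {mdist Y (f x) (f y) |x y. x \<in> mspace Z \<and> y \<in> mspace Z \<and> s \<le> mdist Z x y}"
    by (rule bdd_belowI[of _ 0]) auto
qed (use assms in fastforce)

lemma asymptotic_compression_compose_ge:
  assumes "unbounded_metric X" and "quasi_isometry X Z \<phi>"
  shows "asymptotic_compression Z Y f \<le> asymptotic_compression X Y (f \<circ> \<phi>)"
proof -
  obtain C D where \<phi>: "\<phi> \<in> mspace X \<rightarrow> mspace Z" and C: "C > 0"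
    and lo: "\<And>x x'. x \<in> mspace X \<Longrightarrow> x' \<in> mspace X \<Longrightarrow>
      inverse C * mdist X x x' - D \<le> mdist Z (\<phi> x) (\<phi> x')"
    using assms(2) unfolding quasi_isometry_def by blast
  define s where "s = (\<lambda>r. inverse C * r - D)"
  define g where "g = (\<lambda>t. ln (max (compression Z Y f t) 1))"
  define h where "h = (\<lambda>r. ln (max (compression X Y (f \<circ> \<phi>) r) 1))"
  have g_le_h: "g (s r) \<le> h r" for r
  proof -
    have "s r \<le> mdist Z (\<phi> x) (\<phi> x')"
      if "x \<in> mspace X" "x' \<in> mspace X" "r \<le> mdist X x x'" for x x'
    proof -
      have "inverse C * r \<le> inverse C * mdist X x x'"
        using that(3) C by (intro mult_left_mono) simp_all
      then show ?thesis
        using lo[OF that(1,2)] unfolding s_def by linarith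
    qed
    then have "compression Z Y f (s r) \<le> compression X Y (f \<circ> \<phi>) r"
      by (intro compression_compose_ge assms(1) \<phi>)
    then show ?thesis
      by (simp add: g_def h_def)
  qed
  have s_top: "filterlim s at_top at_top"
    using C unfolding s_def by real_asymp
  \<comment> \<open>For large \<open>r\<close>, \<open>ln (s r)\<close> is
    \<open>ln r + ln (inverse C - D / r)\<close>, and the second summand stays bounded.\<close>
  have ratio: "((\<lambda>r. ln (s r) / ln r) \<longlongrightarrow> 1) at_top"
    using C unfolding s_def by real_asymp
  have "Liminf at_top (\<lambda>t. ereal (g t / ln t)) \<le> Liminf at_top (\<lambda>r. ereal (h r / ln r))"
    unfolding le_Liminf_iff[of "Liminf at_top (\<lambda>t. ereal (g t / ln t))"]
  proof (intro allI impI)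
    fix y assume "y < Liminf at_top (\<lambda>t. ereal (g t / ln t))"
    \<comment> \<open>Two real levels \<open>c < c'\<close> are placed between \<open>y\<close> and
      the liminf, which may be infinite; the gap between them absorbs the factor
      \<open>ln (s r) / ln r\<close>.\<close>
    then obtain c where c: "ereal c < Liminf at_top (\<lambda>t. ereal (g t / ln t))" "y < ereal c"
      using ereal_dense2 by blast
    then obtain c' where c': "ereal c' < Liminf at_top (\<lambda>t. ereal (g t / ln t))" "c < c'"
      using ereal_dense2 by (metis less_ereal.simps(1))
    have "eventually (\<lambda>t. c' < g t / ln t) at_top"
      using less_LiminfD[OF c'(1)] by simp
    then have "eventually (\<lambda>r. c' < g (s r) / ln (s r)) at_top"
      using s_top by (rule eventually_compose_filterlim)
    \<comment> \<open>Makes \<open>ln (s r)\<close> positive, so that the quotient bound can be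
      multiplied out.\<close>
    moreover have "eventually (\<lambda>r. 1 < s r) at_top"
      using s_top by (simp add: filterlim_at_top_dense)
    moreover have "eventually (\<lambda>r. c < c' * (ln (s r) / ln r)) at_top"
      using tendsto_mult_left[OF ratio, of c'] c'(2) by (auto dest: order_tendstoD(1))
    ultimately show "eventually (\<lambda>r. y < ereal (h r / ln r)) at_top"
      using eventually_gt_at_top[of 1]
    proof eventually_elim
      case (elim r)
      have "c' * ln (s r) \<le> h r"
        using elim g_le_h[of r] by (simp add: field_simps)
      then have "c' * (ln (s r) / ln r) \<le> h r / ln r"
        using elim by (simp add: divide_right_mono)
      then have "c < h r / ln r"
        using elim by linarith
      then show ?case
        using c(2) by (meson less_ereal.simps(1) less_trans)
    qed
  qed
  then show ?thesis
    by (simp add: asymptotic_compression_def g_def h_def)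
qed

text \<open>Each \<open>f\<close> on \<open>Z\<close> is matched by \<open>f \<circ> \<phi>\<close>
  on \<open>X\<close>, whose asymptotic compression is at least as large.\<close>

lemma compression_in_le:
  assumes "unbounded_metric X" and "quasi_isometric X Z"
  shows "compression_in Z Y \<le> compression_in X Y"
proof -
  obtain \<phi> where \<phi>: "quasi_isometry X Z \<phi>"
    using assms(2) unfolding quasi_isometric_def by blast
  show ?thesis
    unfolding compression_in_def
    using asymptotic_compression_compose_ge[OF assms(1) \<phi>]
      ls_Lipschitz_maps_compose[OF quasi_isometry_imp_ls_Lipschitz[OF \<phi>]]
    by (intro SUP_mono) blast
qed

theorem corollary2p13:
  fixes X\<^sub>1 :: "'a metric" and X\<^sub>2 :: "'b metric"
  assumes "unbounded_metric X\<^sub>1" and "unbounded_metric X\<^sub>2"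
    and "quasi_isometric X\<^sub>1 X\<^sub>2"
  shows "\<forall>Y :: 'c metric. compression_in X\<^sub>1 Y = compression_in X\<^sub>2 Y"
  \<comment> \<open>Each inequality uses unboundedness of the space on which the composite maps
    live.\<close>
  using assms by (blast intro: antisym compression_in_le quasi_isometric_sym)

end
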